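(* Assume $\frac{1}{n}\leq a<b\leq \frac{n-1}{n}$. Then the random dictator rule $f(\nu)=\nu$ is the unique regret-minimizing aggregation rule (i.e. the unique minimizer of $\mathrm{Reg}(f)$ over all aggregation rules $f$), and $\mathrm{Reg}=1-(1-\mu)(1-a)-\mu b$.
   Context: Setting: fix a number of agents $n\ge 1$, a prior $\mu\in(0,1)$ and posteriors $0\le p_1<\frac12<p_2\le 1$ with $p_1<\mu<p_2$. An information structure is a probability distribution $\pi$ on $\{0,1\}\times\{L,H\}^n$, the law of $(\omega,s_1,\dots,s_n)$ (state and binary signals of the $n$ agents), such that $\pi(\omega=1)=\mu$ and, for every $i$, both values of $s_i$ have positive probability and $\pi(\omega=1\mid s_i=L)=p_1$, $\pi(\omega=1\mid s_i=H)=p_2$. Define $$a=\frac{(1-p_2)(\mu-p_1)}{(1-\mu)(p_2-p_1)},\qquad b=\frac{p_2(\mu-p_1)}{\mu(p_2-p_1)},$$ which are the probabilities that a given agent gets signal $H$ conditional on $\omega=0$ and $\omega=1$, respectively. Let $\nu\in\{0,\frac1n,\dots,1\}$ be the fraction of agents $i$ with $s_i=H$; $\hat\pi$ is the law of $(\omega,\nu)$ induced by $\pi$, and $\hat\pi_0,\hat\pi_1$ are the conditional laws of $\nu$ given $\omega=0$ and $\omega=1$. An aggregation rule is a function $f:\{0,\frac1n,\dots,1\}\to[0,1]$ ($f(\nu)$ is the probability that the decision maker guesses $\omega=1$ after observing $\nu$). The probability of a correct guess is $P(f,\pi)=\mu\,\mathbb{E}_{\nu\sim\hat\pi_1}[f(\nu)]+(1-\mu)\,\mathbb{E}_{\nu\sim\hat\pi_0}[1-f(\nu)]$;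 that of a Bayesian decision maker who knows $\pi$ is $P^*(\pi)=\mathbb{E}_{\nu\sim\hat\pi}[\max\{\hat\pi(\omega=0\mid\nu),\hat\pi(\omega=1\mid\nu)\}]$. Regret: $\mathrm{Reg}(f,\pi)=P^*(\pi)-P(f,\pi)$, $\mathrm{Reg}(f)=\max_\pi \mathrm{Reg}(f,\pi)$ over all information structures $\pi$ (with the given $n,\mu,p_1,p_2$), and $\mathrm{Reg}=\min_f\mathrm{Reg}(f)$ over all aggregation rules. The random dictator rule is $f(\frac kn)=\frac kn$ for $0\le k\le n$. *)

theory Defs
  imports "HOL-Probability.Probability"
begin

datatype signal = SigL | SigH

text \<open>
  The state is a \<^typ>\<open>bool\<close>, with \<^const>\<open>True\<close> for \<open>\<omega> = 1\<close>. A signal profile in \<open>{L, H}\<^sup>n\<close> is a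
  list of length \<open>n\<close>, so the agents are the indices \<open>0, \<dots>, n - 1\<close>.
\<close>

definition info_structures ::
    "nat \<Rightarrow> real \<Rightarrow> real \<Rightarrow> real \<Rightarrow> (bool \<times> signal list) pmf set" where
  "info_structures n \<mu> p1 p2 = {\<pi>.
     set_pmf \<pi> \<subseteq> UNIV \<times> {s. length s = n} \<and>
     \<P>(x in measure_pmf \<pi>. fst x) = \<mu> \<and>
     (\<forall>i<n.
        \<P>(x in measure_pmf \<pi>. snd x ! i = SigL) > 0 \<and>
        \<P>(x in measure_pmf \<pi>. snd x ! i = SigH) > 0 \<and>
        \<P>(x in measure_pmf \<pi>. fst x \<bar> snd x ! i = SigL) = p1 \<and>
        \<P>(x in measure_pmf \<pi>. fst x \<bar> snd x ! i = SigH) = p2)}"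

definition prob_H_state0 :: "real \<Rightarrow> real \<Rightarrow> real \<Rightarrow> real" where
  "prob_H_state0 \<mu> p1 p2 = ((1 - p2) * (\<mu> - p1)) / ((1 - \<mu>) * (p2 - p1))"

definition prob_H_state1 :: "real \<Rightarrow> real \<Rightarrow> real \<Rightarrow> real" where
  "prob_H_state1 \<mu> p1 p2 = (p2 * (\<mu> - p1)) / (\<mu> * (p2 - p1))"

definition frac_grid :: "nat \<Rightarrow> real set" where
  "frac_grid n = (\<lambda>k. real k / real n) ` {0..n}"

definition frac_H :: "nat \<Rightarrow> signal list \<Rightarrow> real" where
  "frac_H n s = real (card {i. i < n \<and> s ! i = SigH}) / real n"

definition induced :: "nat \<Rightarrow> (bool \<times> signal list) pmf \<Rightarrow> (bool \<times> real) pmf" where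
  "induced n \<pi> = map_pmf (\<lambda>(\<omega>, s). (\<omega>, frac_H n s)) \<pi>"

definition induced_given :: "nat \<Rightarrow> (bool \<times> signal list) pmf \<Rightarrow> bool \<Rightarrow> real pmf" where
  "induced_given n \<pi> \<omega> = map_pmf snd (cond_pmf (induced n \<pi>) {x. fst x = \<omega>})"

text \<open>
  Rules are extensional functions on the grid, so that equality of rules is equality of their
  values on the grid.
\<close>

definition aggregation_rules :: "nat \<Rightarrow> (real \<Rightarrow> real) set" where
  "aggregation_rules n = frac_grid n \<rightarrow>\<^sub>E {0..1}"

definition random_dictator :: "nat \<Rightarrow> real \<Rightarrow> real" where
  "random_dictator n = (\<lambda>\<nu>\<in>frac_grid n. \<nu>)"

definition prob_correct ::
    "nat \<Rightarrow> real \<Rightarrow> (real \<Rightarrow> real) \<Rightarrow> (bool \<times> signal list) pmf \<Rightarrow> real" where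
  "prob_correct n \<mu> f \<pi> =
     \<mu> * measure_pmf.expectation (induced_given n \<pi> True) (\<lambda>\<nu>. f \<nu>)
     + (1 - \<mu>) * measure_pmf.expectation (induced_given n \<pi> False) (\<lambda>\<nu>. 1 - f \<nu>)"

definition prob_correct_bayes :: "nat \<Rightarrow> (bool \<times> signal list) pmf \<Rightarrow> real" where
  "prob_correct_bayes n \<pi> =
     measure_pmf.expectation (map_pmf snd (induced n \<pi>))
       (\<lambda>\<nu>. max \<P>(x in measure_pmf (induced n \<pi>). \<not> fst x \<bar> snd x = \<nu>)
                \<P>(x in measure_pmf (induced n \<pi>). fst x \<bar> snd x = \<nu>))"

definition regret ::
    "nat \<Rightarrow> real \<Rightarrow> (real \<Rightarrow> real) \<Rightarrow> (bool \<times> signal list) pmf \<Rightarrow> real" where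
  "regret n \<mu> f \<pi> = prob_correct_bayes n \<pi> - prob_correct n \<mu> f \<pi>"

text \<open>
  The maximum and the minimum below are a greatest and a least element, not a supremum and an
  infimum. The maximum exists because the regret is continuous in \<open>\<pi>\<close> and the information
  structures form a nonempty compact polytope: the posteriors fix the probability of each
  signal, so the strict positivity conditions are redundant as long as \<open>p1 < \<mu> < p2\<close>.
\<close>

definition worst_regret ::
    "nat \<Rightarrow> real \<Rightarrow> real \<Rightarrow> real \<Rightarrow> (real \<Rightarrow> real) \<Rightarrow> real" where
  "worst_regret n \<mu> p1 p2 f = (GREATEST r. r \<in> regret n \<mu> f ` info_structures n \<mu> p1 p2)"

definition min_regret :: "nat \<Rightarrow> real \<Rightarrow> real \<Rightarrow> real \<Rightarrow> real" where
  "min_regret n \<mu> p1 p2 = (LEAST r. r \<in> worst_regret n \<mu> p1 p2 ` aggregation_rules n)"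

end

theory Submission
  imports Defs
begin

text \<open>
  The regret depends on \<open>\<pi>\<close> only through the two laws of the number of \<open>H\<close> signals given the
  state, and every pair of laws on \<open>{0, \<dots>, n}\<close> with means \<open>n a\<close> and \<open>n b\<close> arises. The random
  dictator guesses correctly with probability \<open>\<mu> b + (1 - \<mu>) (1 - a)\<close> whatever these laws are, so
  its regret is largest when they have disjoint supports, i.e. when \<open>\<nu>\<close> reveals the state.

  Conversely, let \<open>f\<close> be a rule that does no worse, and subtract from \<open>f(\<nu>) - \<nu>\<close> the chord through
  its end points to obtain \<open>h\<close>. As the means are fixed, the chord contributes the same amount \<open>\<kappa>\<close> for
  every structure, and \<open>\<kappa> \<ge> 0\<close> because \<open>p1 < 1/2 < p2\<close>. Hence
  \<open>\<mu> E\<^sub>1[h] - (1 - \<mu>) E\<^sub>0[h] \<ge> \<kappa>\<close> for all laws with disjoint supports. Two-point laws on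
  \<open>{0, 1/n, (n-1)/n, 1}\<close> then force \<open>h = 0\<close> at \<open>1/n\<close> and \<open>(n-1)/n\<close>, whence \<open>\<kappa> = 0\<close> and \<open>h = 0\<close>
  everywhere; strictness of \<open>p1 < 1/2 < p2\<close> finally makes the chord vanish.
\<close>

section \<open>Two-point laws\<close>

text \<open>The value at \<open>t\<close> of the affine function through \<open>(i, g i)\<close> and
  \<open>(j, g j)\<close>. For \<open>t\<close> between \<open>i\<close> and \<open>j\<close> it is
  also the expectation of \<open>g\<close> under the law on \<open>{i, j}\<close> with mean
  \<open>t\<close>.\<close>

definition interp :: "(nat \<Rightarrow> real) \<Rightarrow> nat \<Rightarrow> nat \<Rightarrow> real \<Rightarrow> real" where
  "interp g i j t = ((real j - t) * g i + (t - real i) * g j) / (real j - real i)"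

text \<open>The law on \<open>{i, j}\<close> with mean \<open>t\<close>, scaled to total mass
  \<open>w\<close>. The scale is later the prior probability of a state, so that joint rather than
  conditional masses result.\<close>

definition two_point :: "real \<Rightarrow> nat \<Rightarrow> nat \<Rightarrow> real \<Rightarrow> nat \<Rightarrow> real" where
  "two_point w i j t k =
     (if k = i then w * (real j - t) / (real j - real i)
      else if k = j then w * (t - real i) / (real j - real i) else 0)"

lemma sum_two_point:
  assumes "i < j" "j \<le> n"
  shows "(\<Sum>k\<le>n. g k * two_point w i j t k) = w * interp g i j t"
proof -
  have "(\<Sum>k\<le>n. g k * two_point w i j t k) = (\<Sum>k\<in>{i,j}. g k * two_point w i j t k)"
    using assms by (intro sum.mono_neutral_right) (auto simp: two_point_def)
  also have "\<dots> = w * interp g i j t"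
    using assms by (simp add: two_point_def interp_def add_divide_distrib distrib_left mult_ac)
  finally show ?thesis .
qed

text \<open>Affine functions are their own interpolants. Hence an affine change of a rule shifts its
  expectation by an amount that depends on the mean \<open>t\<close> alone, not on \<open>i\<close>
  and \<open>j\<close>.\<close>

lemma interp_affine:
  assumes "i < j"
  shows "interp (\<lambda>k. g k + (c + d * real k)) i j t = interp g i j t + (c + d * t)"
proof -
  have "real j - real i \<noteq> 0" using assms by simp
  then show ?thesis unfolding interp_def
    by (simp add: divide_simps) (simp add: algebra_simps)
qed

lemma interp_const: "i < j \<Longrightarrow> interp (\<lambda>_. c) i j t = c"
  using interp_affine[of i j "\<lambda>_. 0" c 0 t] by (simp add: interp_def)

lemma interp_id: "i < j \<Longrightarrow> interp real i j t = t"
  using interp_affine[of i j "\<lambda>_. 0" 0 1 t] by (simp add: interp_def)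

lemma two_point_nonneg:
  assumes "0 \<le> w" "i < j" "real i \<le> t" "t \<le> real j"
  shows "0 \<le> two_point w i j t k"
  using assms by (auto simp: two_point_def)

text \<open>The four ways of splitting 0, 1, \<open>n - 1\<close>, \<open>n\<close> into supports of
  the two states give linear inequalities in \<open>h 1\<close> and \<open>h (n - 1)\<close> whose
  signs clash unless both vanish. Any other point is then tested against the pair
  \<open>{1, n - 1}\<close>, on which \<open>h\<close> is already known to be 0.\<close>

lemma interp_rigidity:
  fixes h :: "nat \<Rightarrow> real"
  assumes A: "1 \<le> A" and AB: "A < B" and B: "B \<le> real n - 1"
    and w: "0 < w0" "0 < w1" and \<kappa>: "0 \<le> \<kappa>"
    and h0: "h 0 = 0" and hn: "h n = 0"
    and H: "\<And>i0 j0 i1 j1. \<lbrakk>i0 < j0; j0 \<le> n; i1 < j1; j1 \<le> n; {i0, j0} \<inter> {i1, j1} = {};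
        real i0 \<le> A; A \<le> real j0; real i1 \<le> B; B \<le> real j1\<rbrakk>
        \<Longrightarrow> \<kappa> \<le> w1 * interp h i1 j1 B - w0 * interp h i0 j0 A"
  shows "\<kappa> = 0" and "\<And>k. k \<le> n \<Longrightarrow> h k = 0"
proof -
  \<comment> \<open>The interval from 1 to \<open>n - 1\<close> contains both \<open>A\<close> and
    \<open>B\<close>, so it is nondegenerate and 0, 1, \<open>n - 1\<close>, \<open>n\<close> are
    four distinct points.\<close>
  have n3: "n \<ge> 3"
    using assms by linarith
  define m where "m = n - 1"
  have nm: "n = Suc m" and m2: "m \<ge> 2" using n3 by (auto simp: m_def)
  have Bm: "B \<le> real m" using B nm by simp
  have SA: "\<kappa> \<le> w1 * (((m - B) * h 1 + (B - 1) * h m) / (real m - 1))"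
    using H[of 0 n 1 m] assms m2 nm by (simp add: interp_def)
  have SB: "\<kappa> \<le> - (w0 * (((m - A) * h 1 + (A - 1) * h m) / (real m - 1)))"
    using H[of 1 m 0 n] assms m2 nm by (simp add: interp_def)
  have SC: "\<kappa> \<le> w1 * ((n - B) * h 1 / m) - w0 * (A * h m / m)"
    using H[of 0 m 1 n] assms m2 nm by (simp add: interp_def)
  have SD: "\<kappa> \<le> w1 * (B * h m / m) - w0 * ((n - A) * h 1 / m)"
    using H[of 1 n 0 m] assms m2 nm by (simp add: interp_def)
  have m1: "real m - 1 > 0" "real m > 0" using m2 by auto
  have "0 \<le> w1 * (((m - B) * h 1 + (B - 1) * h m) / (real m - 1))" using SA \<kappa> by linarith
  then have SA': "0 \<le> (m - B) * h 1 + (B - 1) * h m"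
    using m1 w by (simp add: zero_le_mult_iff zero_le_divide_iff)
  have "w0 * (((m - A) * h 1 + (A - 1) * h m) / (real m - 1)) \<le> 0" using SB \<kappa> by linarith
  then have SB': "(m - A) * h 1 + (A - 1) * h m \<le> 0"
    using m1 w by (simp add: mult_le_0_iff divide_le_0_iff)
  have "w0 * (A * h m / m) \<le> w1 * ((n - B) * h 1 / m)" using SC \<kappa> by linarith
  then have SC': "w0 * A * h m \<le> w1 * (n - B) * h 1"
    using m1 by (simp add: divide_le_cancel mult.assoc)
  have "w0 * ((n - A) * h 1 / m) \<le> w1 * (B * h m / m)" using SD \<kappa> by linarith
  then have SD': "w0 * (n - A) * h 1 \<le> w1 * B * h m"
    using m1 by (simp add: divide_le_cancel mult.assoc)
  \<comment> \<open>\<open>m - A\<close> and \<open>B - 1\<close> are strictly positive because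
    \<open>A < B\<close>, whereas \<open>m - B\<close> and \<open>A - 1\<close> may be 0. The sign
    arguments below therefore use strictness only for the former two.\<close>
  have pos: "w0 * A > 0" "w1 * (n - B) > 0" "w0 * (n - A) > 0" "w1 * B > 0"
    "real m - A > 0" "B - 1 > 0" "real m - B \<ge> 0" "A - 1 \<ge> 0"
    using A AB B w Bm by auto
  \<comment> \<open>If \<open>h 1 > 0\<close>, then \<open>SD'\<close> makes \<open>h m\<close>
    positive as well, and \<open>SB'\<close> fails; if \<open>h 1 < 0\<close>, then
    \<open>SC'\<close> makes \<open>h m\<close> negative, and \<open>SA'\<close> fails.\<close>
  have "\<not> h 1 > 0"
  proof
    assume 1: "h 1 > 0"
    then have "0 < w1 * B * h m" using SD' mult_pos_pos[OF pos(3) 1] by linarith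
    then have "h m > 0" using pos(4) zero_less_mult_pos by blast
    then show False
      using SB' mult_pos_pos[OF pos(5) 1] mult_nonneg_nonneg[OF pos(8), of "h m"] by linarith
  qed
  moreover have "\<not> h 1 < 0"
  proof
    assume 1: "h 1 < 0"
    then have "w0 * A * h m < 0" using SC' mult_pos_neg[OF pos(2) 1] by linarith
    then have "h m < 0" using pos(1) mult_nonneg_nonneg[of "w0 * A" "h m"] by linarith
    then show False
      using SA' mult_pos_neg[OF pos(6), of "h m"] mult_nonneg_nonpos[OF pos(7), of "h 1"] 1 by linarith
  qed
  ultimately have h1: "h 1 = 0" by linarith
  have hm: "h m = 0"
    using SC' SD' pos mult_pos_pos[of "w0 * A" "h m"] mult_pos_neg[of "w1 * B" "h m"]
    unfolding h1 by (metis linorder_neqE_linordered_idom mult_zero_right not_less)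
  show \<kappa>0: "\<kappa> = 0" using SA \<kappa> unfolding h1 hm by simp
  fix k assume "k \<le> n"
  then consider "k = 0" | "k = 1" | "k = m" | "k = n" | "1 < k" "k < m"
    using nm by linarith
  then show "h k = 0"
  proof cases
    case 5
    \<comment> \<open>State 1 is placed on \<open>{1, m}\<close>, where \<open>h\<close> vanishes,
      and state 0 on \<open>k\<close> together with whichever of 0 and \<open>n\<close> leaves
      \<open>A\<close> between them. Exchanging the states gives the reverse inequality.\<close>
    have "h k \<le> 0"
    proof (cases "A \<le> k")
      case True
      then show ?thesis
        using H[of 0 k 1 m] assms 5 nm h1 hm \<kappa>0 Bm
        by (auto simp: interp_def mult_le_0_iff divide_le_0_iff)
    next
      case False
      then show ?thesis
        using H[of k n 1 m] assms 5 nm h1 hm \<kappa>0 Bm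
        by (auto simp: interp_def mult_le_0_iff divide_le_0_iff)
    qed
    moreover have "0 \<le> h k"
    proof (cases "B \<le> k")
      case True
      then show ?thesis
        using H[of 1 m 0 k] assms 5 nm h1 hm \<kappa>0 Bm
        by (auto simp: interp_def zero_le_mult_iff zero_le_divide_iff)
    next
      case False
      then show ?thesis
        using H[of 1 m k n] assms 5 nm h1 hm \<kappa>0 Bm
        by (auto simp: interp_def zero_le_mult_iff zero_le_divide_iff)
    qed
    ultimately show ?thesis by simp
  qed (use h0 hn h1 hm in auto)
qed

section \<open>Laws of the signal count\<close>

text \<open>
  \<open>m (\<omega>, k)\<close> is the joint probability of the state \<open>\<omega>\<close> and of \<open>k\<close> signals \<open>H\<close>; \<open>c0\<close> and \<open>c1\<close> are
  the joint probabilities that a given agent gets \<open>H\<close> and that the state is \<open>0\<close>, respectively \<open>1\<close>.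
\<close>

definition count_laws :: "nat \<Rightarrow> real \<Rightarrow> real \<Rightarrow> real \<Rightarrow> (bool \<times> nat \<Rightarrow> real) set" where
  "count_laws n \<mu> c0 c1 = {m.
     (\<forall>\<omega> k. 0 \<le> m (\<omega>, k)) \<and> (\<forall>\<omega> k. n < k \<longrightarrow> m (\<omega>, k) = 0) \<and>
     (\<Sum>k\<le>n. m (True, k)) = \<mu> \<and> (\<Sum>k\<le>n. m (False, k)) = 1 - \<mu> \<and>
     (\<Sum>k\<le>n. real k * m (True, k)) = real n * c1 \<and>
     (\<Sum>k\<le>n. real k * m (False, k)) = real n * c0}"

text \<open>In terms of joint masses the Bayesian payoff involves no conditioning: the larger
  posterior times the probability of the count is the larger joint mass.\<close>

definition count_regret :: "nat \<Rightarrow> (real \<Rightarrow> real) \<Rightarrow> (bool \<times> nat \<Rightarrow> real) \<Rightarrow> real" where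
  "count_regret n f m = (\<Sum>k\<le>n. max (m (True, k)) (m (False, k)))
     - (\<Sum>k\<le>n. f (real k / real n) * m (True, k))
     - (\<Sum>k\<le>n. (1 - f (real k / real n)) * m (False, k))"

section \<open>Compactness of the set of count laws and continuity of the regret\<close>

lemma count_laws_le_1:
  assumes "m \<in> count_laws n \<mu> c0 c1" "0 \<le> \<mu>" "\<mu> \<le> 1"
  shows "m (\<omega>, k) \<le> 1"
proof (cases "k \<le> n")
  case True
  then have "m (\<omega>, k) \<le> (\<Sum>k\<le>n. m (\<omega>, k))"
    using assms by (intro member_le_sum) (auto simp: count_laws_def)
  also have "\<dots> \<le> 1" using assms by (cases \<omega>) (auto simp: count_laws_def)
  finally show ?thesis .
qed (use assms in \<open>auto simp: count_laws_def\<close>)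

text \<open>Linear equations and inequalities cut out a closed subset of the cube of functions into
  \<open>{0..1}\<close>, which is compact in the product topology. This is what makes worst-case
  regrets attained.\<close>

lemma compact_count_laws:
  assumes "0 \<le> \<mu>" "\<mu> \<le> 1"
  shows "compact (count_laws n \<mu> c0 c1)"
proof -
  let ?P = "PiE UNIV (\<lambda>_. {0..1::real}) :: (bool \<times> nat \<Rightarrow> real) set"
  have "compactin (product_topology (\<lambda>_. euclideanreal) UNIV) ?P"
    by (subst compactin_PiE) auto
  then have P: "compact ?P"
    by (simp add: euclidean_product_topology)
  have cont: "continuous_on UNIV (\<lambda>m. \<Sum>k\<le>n. g k * m (\<omega>, k))"
    for g :: "nat \<Rightarrow> real" and \<omega> :: bool
    by (intro continuous_on_sum continuous_on_mult continuous_on_const continuous_on_product_coordinates)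
  have lin: "closed {m. (\<Sum>k\<le>n. g k * m (\<omega>, k)) = c}"
    for g :: "nat \<Rightarrow> real" and \<omega> :: bool and c
    by (rule closed_Collect_eq[OF cont continuous_on_const])
  have nonneg: "closed {m :: bool \<times> nat \<Rightarrow> real. 0 \<le> m x}" for x
    by (rule closed_Collect_le[OF continuous_on_const continuous_on_product_coordinates])
  have zero: "closed {m :: bool \<times> nat \<Rightarrow> real. m x = 0}" for x
    by (rule closed_Collect_eq[OF continuous_on_product_coordinates continuous_on_const])
  have supp: "closed {m :: bool \<times> nat \<Rightarrow> real. n < k \<longrightarrow> m x = 0}" for x k
    using zero[of x] by (cases "n < k") simp_all
  \<comment> \<open>The factor 1 in the two total-mass conditions makes them instances of
    \<open>lin\<close>.\<close>
  have eq: "count_laws n \<mu> c0 c1 =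
      (\<Inter>x. {m. 0 \<le> m x}) \<inter> (\<Inter>\<omega>. \<Inter>k. {m. n < k \<longrightarrow> m (\<omega>, k) = 0})
      \<inter> {m. (\<Sum>k\<le>n. 1 * m (True, k)) = \<mu>} \<inter> {m. (\<Sum>k\<le>n. 1 * m (False, k)) = 1 - \<mu>}
      \<inter> {m. (\<Sum>k\<le>n. real k * m (True, k)) = real n * c1}
      \<inter> {m. (\<Sum>k\<le>n. real k * m (False, k)) = real n * c0}"
    by (auto simp: count_laws_def)
  have nonneg': "closed (\<Inter>x. {m :: bool \<times> nat \<Rightarrow> real. 0 \<le> m x})"
    using nonneg by (simp add: closed_INT)
  have supp': "closed (\<Inter>\<omega>. \<Inter>k. {m :: bool \<times> nat \<Rightarrow> real. n < k \<longrightarrow> m (\<omega>, k) = 0})"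
    using supp by (simp add: closed_INT)
  have "closed (count_laws n \<mu> c0 c1)"
    unfolding eq
    by (rule closed_Int[OF closed_Int[OF closed_Int[OF closed_Int[OF closed_Int[OF nonneg' supp']
          lin[of "\<lambda>_. 1" True \<mu>]] lin[of "\<lambda>_. 1" False "1 - \<mu>"]]
          lin[of real True "real n * c1"]] lin[of real False "real n * c0"]])
  moreover have "count_laws n \<mu> c0 c1 \<subseteq> ?P"
  proof
    fix m assume m: "m \<in> count_laws n \<mu> c0 c1"
    have "0 \<le> m x \<and> m x \<le> 1" for x
      using m count_laws_le_1[OF m assms] by (cases x) (simp add: count_laws_def)
    then show "m \<in> ?P" by (simp add: PiE_iff)
  qed
  ultimately show ?thesis
    using P compact_Int_closed[of ?P "count_laws n \<mu> c0 c1"] by (simp add: inf.absorb2)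
qed

lemma continuous_on_count_regret: "continuous_on S (count_regret n f)"
proof -
  have "continuous_on UNIV (count_regret n f)"
    unfolding count_regret_def
    by (intro continuous_on_diff continuous_on_sum continuous_on_max continuous_on_mult
        continuous_on_const continuous_on_product_coordinates)
  then show ?thesis by (rule continuous_on_subset) simp
qed

section \<open>Two-point laws as test structures\<close>

lemma two_point_count_law:
  assumes "0 \<le> \<mu>" "\<mu> \<le> 1" "i0 < j0" "j0 \<le> n" "i1 < j1" "j1 \<le> n"
    and "real i0 \<le> real n * a" "real n * a \<le> real j0" "real i1 \<le> real n * b" "real n * b \<le> real j1"
  shows "(\<lambda>(\<omega>, k). if \<omega> then two_point \<mu> i1 j1 (real n * b) k
            else two_point (1 - \<mu>) i0 j0 (real n * a) k)
         \<in> count_laws n \<mu> ((1 - \<mu>) * a) (\<mu> * b)"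
proof -
  note s = sum_two_point[of _ _ n "\<lambda>_. 1"] sum_two_point[of _ _ n real]
  show ?thesis
    using assms s[of i0 j0] s[of i1 j1]
    by (auto simp: count_laws_def interp_const interp_id intro!: two_point_nonneg) (auto simp: two_point_def)
qed

text \<open>With disjoint supports the count reveals the state, so the Bayesian guess is always
  right and the regret is the error probability of \<open>f\<close>.\<close>

lemma count_regret_two_point:
  assumes "0 \<le> \<mu>" "\<mu> \<le> 1" "i0 < j0" "j0 \<le> n" "i1 < j1" "j1 \<le> n" "{i0, j0} \<inter> {i1, j1} = {}"
    and "real i0 \<le> s" "s \<le> real j0" "real i1 \<le> t" "t \<le> real j1"
  shows "count_regret n f (\<lambda>(\<omega>, k). if \<omega> then two_point \<mu> i1 j1 t k else two_point (1 - \<mu>) i0 j0 s k)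
         = \<mu> * (1 - interp (\<lambda>k. f (real k / real n)) i1 j1 t)
           + (1 - \<mu>) * interp (\<lambda>k. f (real k / real n)) i0 j0 s"
proof -
  let ?m1 = "two_point \<mu> i1 j1 t" and ?m0 = "two_point (1 - \<mu>) i0 j0 s"
  let ?f = "\<lambda>k. f (real k / real n)"
  have "max (?m1 k) (?m0 k) = ?m1 k + ?m0 k" for k
  proof (cases "k \<in> {i0, j0}")
    case True
    then have "?m1 k = 0" using assms by (auto simp: two_point_def)
    then show ?thesis using two_point_nonneg[of "1 - \<mu>" i0 j0 s k] assms by simp
  next
    case False
    then have "?m0 k = 0" by (auto simp: two_point_def)
    then show ?thesis using two_point_nonneg[of \<mu> i1 j1 t k] assms by simp
  qed
  then have "count_regret n f (\<lambda>(\<omega>, k). if \<omega> then ?m1 k else ?m0 k)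
      = (\<Sum>k\<le>n. 1 * ?m1 k) - (\<Sum>k\<le>n. ?f k * ?m1 k) + (\<Sum>k\<le>n. ?f k * ?m0 k)"
    by (simp add: count_regret_def sum.distrib sum_subtractf left_diff_distrib)
  then show ?thesis
    using assms by (simp only: sum_two_point interp_const) (simp add: algebra_simps)
qed

text \<open>The bound, tested on two-point laws with disjoint supports, becomes the hypothesis of
  \<open>interp_rigidity\<close> for \<open>f\<close> minus the identity and minus a chord.\<close>

lemma rule_eq_id_if_count_regret_le:
  fixes f :: "real \<Rightarrow> real"
  assumes \<mu>: "0 < \<mu>" "\<mu> < 1" and n: "1 \<le> n"
    and a: "1 / real n \<le> a" and ab: "a < b" and b: "b \<le> (real n - 1) / real n"
    and c1: "(1 - \<mu>) * a < \<mu> * b" and c0: "\<mu> * (1 - b) < (1 - \<mu>) * (1 - a)"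
    and f0: "0 \<le> f 0" and f1: "f 1 \<le> 1"
    and le: "\<And>m. m \<in> count_laws n \<mu> ((1 - \<mu>) * a) (\<mu> * b) \<Longrightarrow>
        count_regret n f m \<le> 1 - (1 - \<mu>) * (1 - a) - \<mu> * b"
    and k: "k \<le> n"
  shows "f (real k / real n) = real k / real n"
proof -
  define g0 where "g0 = f 0"
  define gn where "gn = f 1 - 1"
  let ?f = "\<lambda>k. f (real k / real n)"
  \<comment> \<open>With this \<open>c\<close> and \<open>d\<close>, \<open>h k\<close> is
    \<open>f (k/n) - k/n\<close> minus the chord from \<open>g0\<close> at 0 to \<open>gn\<close> at
    \<open>n\<close>.\<close>
  define c where "c = - g0"
  define d where "d = (g0 - gn - 1) / n"
  define h where "h = (\<lambda>k. ?f k + (c + d * real k))"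
  \<comment> \<open>The increase in error probability when the chord is added to the random
    dictator. It is the same for all laws since the means are fixed, and \<open>g0 \<ge> 0\<close>,
    \<open>gn \<le> 0\<close> make both terms nonnegative.\<close>
  define \<kappa> where "\<kappa> = g0 * ((1 - \<mu>) * (1 - a) - \<mu> * (1 - b)) + (- gn) * (\<mu> * b - (1 - \<mu>) * a)"
  have n0: "real n > 0" using n by simp
  have dn: "d * (real n * t) = (g0 - gn - 1) * t" for t
    using n0 by (simp add: d_def)
  have \<kappa>: "0 \<le> \<kappa>" unfolding \<kappa>_def using c0 c1 f0 f1
    by (intro add_nonneg_nonneg mult_nonneg_nonneg) (auto simp: g0_def gn_def)
  have H: "\<kappa> \<le> \<mu> * interp h i1 j1 (real n * b) - (1 - \<mu>) * interp h i0 j0 (real n * a)"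
    if ij: "i0 < j0" "j0 \<le> n" "i1 < j1" "j1 \<le> n" "{i0, j0} \<inter> {i1, j1} = {}"
      "real i0 \<le> real n * a" "real n * a \<le> real j0" "real i1 \<le> real n * b" "real n * b \<le> real j1"
    for i0 j0 i1 j1
  proof -
    have "\<mu> * (1 - interp ?f i1 j1 (real n * b)) + (1 - \<mu>) * interp ?f i0 j0 (real n * a)
        \<le> 1 - (1 - \<mu>) * (1 - a) - \<mu> * b"
      using le[OF two_point_count_law[of \<mu> i0 j0 n i1 j1 a b]]
        count_regret_two_point[of \<mu> i0 j0 n i1 j1 "real n * a" "real n * b" f] \<mu> ij by simp
    then show ?thesis
      unfolding h_def interp_affine[OF ij(1)] interp_affine[OF ij(3)] dn
      by (simp add: \<kappa>_def c_def algebra_simps)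
  qed
  have AB: "1 \<le> real n * a" "real n * a < real n * b" "real n * b \<le> real n - 1"
    using a ab b n0 by (simp_all add: field_simps)
  have ends: "h 0 = 0" "h n = 0" and \<mu>': "0 < 1 - \<mu>"
    using n0 \<mu> by (simp_all add: h_def c_def d_def g0_def gn_def)
  have h1: "\<kappa> = 0"
    by (rule interp_rigidity(1)[OF AB \<mu>' \<mu>(1) \<kappa> ends]) (rule H)
  have h2: "h k = 0"
    by (rule interp_rigidity(2)[OF AB \<mu>' \<mu>(1) \<kappa> ends _ k]) (rule H)
  \<comment> \<open>Both terms of \<kappa> are nonnegative with sum 0; their other factors are
    strictly positive, so the chord is 0.\<close>
  have "g0 * ((1 - \<mu>) * (1 - a) - \<mu> * (1 - b)) \<ge> 0" "(- gn) * (\<mu> * b - (1 - \<mu>) * a) \<ge> 0"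
    using c0 c1 f0 f1 by (auto simp: g0_def gn_def intro!: mult_nonneg_nonneg mult_nonpos_nonneg)
  then have "g0 * ((1 - \<mu>) * (1 - a) - \<mu> * (1 - b)) = 0" "(- gn) * (\<mu> * b - (1 - \<mu>) * a) = 0"
    using h1 unfolding \<kappa>_def by linarith+
  then have "g0 = 0" "gn = 0" using c0 c1 by auto
  then show ?thesis using h2 by (simp add: h_def c_def d_def)
qed

section \<open>Worst-case regret of the random dictator\<close>

lemma count_regret_id_le:
  assumes n: "1 \<le> n" and m: "m \<in> count_laws n \<mu> c0 c1"
    and f: "\<And>k. k \<le> n \<Longrightarrow> f (real k / real n) = real k / real n"
  shows "count_regret n f m \<le> \<mu> - c1 + c0"
proof -
  \<comment> \<open>The Bayesian payoff is at most the total mass, with equality when the supports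
    are disjoint.\<close>
  have "(\<Sum>k\<le>n. max (m (True, k)) (m (False, k))) \<le> (\<Sum>k\<le>n. m (True, k) + m (False, k))"
    using m by (intro sum_mono) (auto simp: count_laws_def)
  \<comment> \<open>For the identity rule the payoff is made of the means, which
    \<open>count_laws\<close> prescribes.\<close>
  moreover have "(\<Sum>k\<le>n. f (real k / real n) * m (True, k)) = (\<Sum>k\<le>n. real k * m (True, k)) / n"
    unfolding sum_divide_distrib by (intro sum.cong) (auto simp: f)
  moreover have "(\<Sum>k\<le>n. (1 - f (real k / real n)) * m (False, k))
      = (\<Sum>k\<le>n. m (False, k)) - (\<Sum>k\<le>n. real k * m (False, k)) / n"
    unfolding sum_divide_distrib sum_subtractf[symmetric]
    by (intro sum.cong) (auto simp: f left_diff_distrib)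
  ultimately show ?thesis
    using m n by (simp add: count_regret_def count_laws_def sum.distrib)
qed

lemma count_regret_id_attained:
  assumes "0 \<le> \<mu>" "\<mu> \<le> 1" "1 \<le> n"
    and "1 / real n \<le> a" and "a < b" and "b \<le> (real n - 1) / real n"
    and f: "\<And>k. k \<le> n \<Longrightarrow> f (real k / real n) = real k / real n"
  obtains m where "m \<in> count_laws n \<mu> ((1 - \<mu>) * a) (\<mu> * b)"
    "count_regret n f m = \<mu> - \<mu> * b + (1 - \<mu>) * a"
proof -
  have n0: "real n > 0" using assms by simp
  have AB: "1 \<le> real n * a" "real n * a < real n * b" "real n * b \<le> real n - 1"
    using assms n0 by (simp_all add: field_simps)
  have AB': "1 \<le> real n * b" "real n * a \<le> real n" using AB by linarith+
  have n3: "3 \<le> n" using AB by linarith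
  define i where "i = n - 1"
  have i: "n = Suc i" "2 \<le> i" using n3 by (auto simp: i_def)
  \<comment> \<open>State 1 lives on \<open>{1, n - 1}\<close> and state 0 on \<open>{0, n}\<close>:
    these are disjoint, and \<open>1 \<le> n * b \<le> n - 1\<close> lets the means fit.\<close>
  let ?m = "(\<lambda>(\<omega>, k). if \<omega> then two_point \<mu> 1 i (real n * b) k
            else two_point (1 - \<mu>) 0 n (real n * a) k)"
  have "?m \<in> count_laws n \<mu> ((1 - \<mu>) * a) (\<mu> * b)"
    using assms AB AB' i by (intro two_point_count_law) auto
  moreover have "interp (\<lambda>k. f (real k / real n)) j l (real n * t) = t" if "j < l" "l \<le> n" for j l t
  proof -
    have "interp (\<lambda>k. f (real k / real n)) j l (real n * t) = interp (\<lambda>k. 0 + (0 + 1 / n * real k)) j l (real n * t)"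
      using that by (simp add: interp_def f)
    also have "\<dots> = t"
      unfolding interp_affine[OF that(1)] using n0 by (simp add: interp_def)
    finally show ?thesis .
  qed
  then have "count_regret n f ?m = \<mu> - \<mu> * b + (1 - \<mu>) * a"
    using assms AB AB' i by (subst count_regret_two_point) (auto simp: algebra_simps)
  ultimately show ?thesis using that by blast
qed

section \<open>Information structures and their count laws\<close>

lemma UNIV_signal: "(UNIV :: signal set) = {SigL, SigH}"
  using signal.exhaust by auto

lemma not_SigH_iff: "x \<noteq> SigH \<longleftrightarrow> x = SigL"
  by (cases x) auto

lemma finite_profiles: "finite (UNIV \<times> {s :: signal list. length s = n} :: (bool \<times> signal list) set)"
proof -
  have "finite (UNIV :: signal set)" by (simp add: UNIV_signal)
  from finite_lists_length_eq[OF this, of n] show ?thesis by simp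
qed

lemma prob_state_False: "measure (measure_pmf \<pi>) {x. \<not> fst x} = 1 - measure (measure_pmf \<pi>) {x. fst x}"
  using measure_pmf.prob_compl[of "{x. fst x}" \<pi>]
  by (simp add: Collect_neg_eq Compl_eq_Diff_UNIV)

text \<open>The posteriors must average to the prior, which forces each agent to get H with
  probability \<open>h\<close>. The conditional constraints thereby become linear in \<pi>.\<close>

lemma mem_info_structures_iff:
  assumes p: "p1 < \<mu>" "\<mu> < p2"
  defines "h \<equiv> (\<mu> - p1) / (p2 - p1)"
  shows "\<pi> \<in> info_structures n \<mu> p1 p2 \<longleftrightarrow>
    set_pmf \<pi> \<subseteq> UNIV \<times> {s. length s = n} \<and> measure \<pi> {x. fst x} = \<mu> \<and>
    (\<forall>i<n. measure \<pi> {x. fst x \<and> snd x ! i = SigH} = p2 * h \<and>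
           measure \<pi> {x. \<not> fst x \<and> snd x ! i = SigH} = (1 - p2) * h)"
proof -
  have h: "0 < h" "h < 1" and mu: "\<mu> = p2 * h + p1 * (1 - h)"
    using p by (simp_all add: h_def divide_simps) (simp add: algebra_simps)
  have main: "(measure \<pi> {x. snd x ! i = SigL} > 0 \<and> measure \<pi> {x. snd x ! i = SigH} > 0 \<and>
      measure \<pi> {x. fst x \<and> snd x ! i = SigL} / measure \<pi> {x. snd x ! i = SigL} = p1 \<and>
      measure \<pi> {x. fst x \<and> snd x ! i = SigH} / measure \<pi> {x. snd x ! i = SigH} = p2)
     \<longleftrightarrow> (measure \<pi> {x. fst x \<and> snd x ! i = SigH} = p2 * h \<and>
           measure \<pi> {x. \<not> fst x \<and> snd x ! i = SigH} = (1 - p2) * h)"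
    if fst: "measure \<pi> {x. fst x} = \<mu>" for i
  proof -
    let ?H = "measure \<pi> {x. snd x ! i = SigH}" and ?L = "measure \<pi> {x. snd x ! i = SigL}"
    let ?TH = "measure \<pi> {x. fst x \<and> snd x ! i = SigH}"
    let ?TL = "measure \<pi> {x. fst x \<and> snd x ! i = SigL}"
    let ?FH = "measure \<pi> {x. \<not> fst x \<and> snd x ! i = SigH}"
    have split: "measure \<pi> {x. P x} = measure \<pi> {x. Q x \<and> P x} + measure \<pi> {x. \<not> Q x \<and> P x}" for P Q
      by (subst measure_pmf.finite_measure_Union[symmetric]) (auto intro!: arg_cong[where f="measure \<pi>"])
    have L: "?L = 1 - ?H"
      using split[of "\<lambda>_. True" "\<lambda>x. snd x ! i = SigH"] measure_pmf.prob_space[of \<pi>]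
      by (simp add: not_SigH_iff)
    have H: "?H = ?TH + ?FH" by (rule split)
    have T: "\<mu> = ?TH + ?TL"
      using split[of fst "\<lambda>x. snd x ! i = SigH"] fst by (simp add: not_SigH_iff conj_commute)
    show ?thesis
    proof
      assume *: "?L > 0 \<and> ?H > 0 \<and> ?TL / ?L = p1 \<and> ?TH / ?H = p2"
      then have TL: "?TL = p1 * ?L" and TH: "?TH = p2 * ?H" by auto
      \<comment> \<open>Total probability; as \<open>p1 < p2\<close>, it determines
        \<open>?H\<close>.\<close>
      have "\<mu> = p2 * ?H + p1 * (1 - ?H)" using T unfolding TL TH L .
      then have "(p2 - p1) * ?H = (p2 - p1) * h" using mu by (simp add: algebra_simps)
      then have Hh: "?H = h" using p by simp
      show "?TH = p2 * h \<and> ?FH = (1 - p2) * h"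
        using H TH unfolding Hh left_diff_distrib by linarith
    next
      assume *: "?TH = p2 * h \<and> ?FH = (1 - p2) * h"
      then have Hh: "?H = h" using H unfolding left_diff_distrib by linarith
      moreover have "?TL = p1 * (1 - h)" using T * mu by linarith
      ultimately show "?L > 0 \<and> ?H > 0 \<and> ?TL / ?L = p1 \<and> ?TH / ?H = p2"
        using * h unfolding L Hh by simp
    qed
  qed
  show ?thesis
    unfolding info_structures_def using main by (auto simp: cond_prob_def)
qed

section \<open>From an information structure to its count law\<close>

definition count_law :: "nat \<Rightarrow> (bool \<times> signal list) pmf \<Rightarrow> bool \<times> nat \<Rightarrow> real" where
  "count_law n \<pi> = (\<lambda>(\<omega>, k). if k \<le> n then pmf (induced n \<pi>) (\<omega>, real k / real n) else 0)"

lemma set_induced: "set_pmf (induced n \<pi>) \<subseteq> UNIV \<times> frac_grid n"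
proof -
  have "frac_H n s \<in> frac_grid n" for s
    using card_mono[of "{..<n}" "{i. i < n \<and> s ! i = SigH}"]
    unfolding frac_H_def frac_grid_def by (intro imageI) (auto simp: subset_eq)
  then show ?thesis by (auto simp: induced_def)
qed

lemma expectation_grid:
  fixes J :: "(bool \<times> real) pmf" and \<phi> :: "bool \<times> real \<Rightarrow> real"
  assumes "1 \<le> n" "set_pmf J \<subseteq> UNIV \<times> frac_grid n"
  shows "measure_pmf.expectation J \<phi> =
     (\<Sum>k\<le>n. \<phi> (True, real k / real n) * pmf J (True, real k / real n))
     + (\<Sum>k\<le>n. \<phi> (False, real k / real n) * pmf J (False, real k / real n))"
proof -
  have inj: "inj_on (\<lambda>k. real k / real n) {..n}"
    using assms by (auto simp: inj_on_def)
  have "measure_pmf.expectation J \<phi> = (\<Sum>x\<in>UNIV \<times> frac_grid n. \<phi> x * pmf J x)"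
    using assms by (intro integral_measure_pmf_real) (auto simp: frac_grid_def)
  also have "\<dots> = (\<Sum>\<omega>\<in>UNIV. \<Sum>\<nu>\<in>frac_grid n. \<phi> (\<omega>, \<nu>) * pmf J (\<omega>, \<nu>))"
    by (simp add: sum.cartesian_product)
  finally show ?thesis
    by (simp add: UNIV_bool frac_grid_def atLeast0AtMost sum.reindex[OF inj])
qed

lemma sum_count_law:
  assumes "1 \<le> n"
  shows "(\<Sum>k\<le>n. g (real k / real n) * count_law n \<pi> (\<omega>, k)) =
    measure_pmf.expectation (induced n \<pi>) (\<lambda>x. if fst x = \<omega> then g (snd x) else 0)"
  by (subst expectation_grid[OF assms set_induced])
     (cases \<omega>; auto simp: count_law_def intro!: sum.cong)

lemma sum_count_law_1:
  assumes "1 \<le> n"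
  shows "(\<Sum>k\<le>n. count_law n \<pi> (\<omega>, k)) = measure \<pi> {x. fst x = \<omega>}"
proof -
  have "(\<lambda>x. if fst x = \<omega> then 1 else 0) = (indicator {x. fst x = \<omega>} :: bool \<times> real \<Rightarrow> real)"
    by (auto simp: indicator_def)
  then have "(\<Sum>k\<le>n. count_law n \<pi> (\<omega>, k)) =
      measure_pmf.expectation (induced n \<pi>) (indicator {x. fst x = \<omega>})"
    using sum_count_law[OF assms, of "\<lambda>_. 1" \<pi> \<omega>] by simp
  also have "\<dots> = measure \<pi> {x. fst x = \<omega>}"
    by (simp add: induced_def vimage_def case_prod_beta)
  finally show ?thesis .
qed

text \<open>Linearity of expectation: the count is a sum of \<open>n\<close> indicators, each
  contributing \<open>c\<close> jointly with the state, however the signals are correlated.\<close>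

lemma mean_count_law:
  assumes n: "1 \<le> n" and supp: "set_pmf \<pi> \<subseteq> UNIV \<times> {s. length s = n}"
    and i: "\<And>i. i < n \<Longrightarrow> measure \<pi> {x. fst x = \<omega> \<and> snd x ! i = SigH} = c"
  shows "(\<Sum>k\<le>n. real k * count_law n \<pi> (\<omega>, k)) = real n * c"
proof -
  have fin: "finite (set_pmf \<pi>)"
    using supp finite_profiles finite_subset by blast
  have "(\<Sum>k\<le>n. real k * count_law n \<pi> (\<omega>, k)) =
      real n * (\<Sum>k\<le>n. real k / real n * count_law n \<pi> (\<omega>, k))"
    using n by (simp add: sum_distrib_left)
  also have "(\<Sum>k\<le>n. real k / real n * count_law n \<pi> (\<omega>, k)) =
      measure_pmf.expectation \<pi> (\<lambda>x. if fst x = \<omega> then frac_H n (snd x) else 0)"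
    by (subst sum_count_law[OF n]) (simp add: induced_def case_prod_unfold cong: if_cong)
  also have "real n * \<dots> = measure_pmf.expectation \<pi> (\<lambda>x. real n * (if fst x = \<omega> then frac_H n (snd x) else 0))"
    by simp
  also have "(\<lambda>x. real n * (if fst x = \<omega> then frac_H n (snd x) else 0)) =
      (\<lambda>x. \<Sum>i<n. indicator {x. fst x = \<omega> \<and> snd x ! i = SigH} x)"
    using n by (auto simp: frac_H_def fun_eq_iff indicator_def of_bool_def sum.If_cases Int_def)
  also have "measure_pmf.expectation \<pi> \<dots> = (\<Sum>i<n. measure \<pi> {x. fst x = \<omega> \<and> snd x ! i = SigH})"
    by (subst Bochner_Integration.integral_sum) (auto simp: integrable_measure_pmf_finite fin)
  also have "\<dots> = real n * c" using i by simp
  finally show ?thesis .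
qed

lemma count_law_mem_count_laws:
  assumes "1 \<le> n" "p1 < \<mu>" "\<mu> < p2" and \<pi>: "\<pi> \<in> info_structures n \<mu> p1 p2"
  defines "h \<equiv> (\<mu> - p1) / (p2 - p1)"
  shows "count_law n \<pi> \<in> count_laws n \<mu> ((1 - p2) * h) (p2 * h)"
proof -
  have *: "set_pmf \<pi> \<subseteq> UNIV \<times> {s. length s = n}" "measure \<pi> {x. fst x} = \<mu>"
    "\<And>i. i < n \<Longrightarrow> measure \<pi> {x. fst x = True \<and> snd x ! i = SigH} = p2 * h"
    "\<And>i. i < n \<Longrightarrow> measure \<pi> {x. fst x = False \<and> snd x ! i = SigH} = (1 - p2) * h"
    using \<pi> unfolding mem_info_structures_iff[OF assms(2,3)] h_def by auto
  have "measure \<pi> {x. \<not> fst x} = 1 - \<mu>"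
    using prob_state_False[of \<pi>] *(2) by simp
  then show ?thesis
    unfolding count_laws_def
    using mean_count_law[OF assms(1) *(1,3)] mean_count_law[OF assms(1) *(1,4)] *(2)
      sum_count_law_1[OF assms(1)]
    by (auto simp: count_law_def)
qed

text \<open>Multiplying by the probability of the state cancels the normalisation of the conditional
  law and leaves joint masses.\<close>

lemma expectation_induced_given:
  fixes \<pi> :: "(bool \<times> signal list) pmf"
  assumes "1 \<le> n" "measure \<pi> {x. fst x = \<omega>} > 0"
  shows "measure \<pi> {x. fst x = \<omega>} * measure_pmf.expectation (induced_given n \<pi> \<omega>) g
    = (\<Sum>k\<le>n. g (real k / real n) * count_law n \<pi> (\<omega>, k))"
proof -
  let ?J = "induced n \<pi>" and ?S = "{x :: bool \<times> real. fst x = \<omega>}"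
  have J: "measure ?J ?S = measure \<pi> {x. fst x = \<omega>}"
    by (simp add: induced_def vimage_def case_prod_beta)
  \<comment> \<open>\<open>cond_pmf\<close> is meaningful only for events that meet the support; the
    positive probability of the state ensures this.\<close>
  then have ne: "set_pmf ?J \<inter> ?S \<noteq> {}"
    using assms(2) measure_Int_set_pmf[of ?J ?S] by (auto simp: Int_commute)
  have supp: "set_pmf (cond_pmf ?J ?S) \<subseteq> UNIV \<times> frac_grid n"
    using set_induced[of n \<pi>] unfolding set_cond_pmf[OF ne] by blast
  have cond: "pmf (cond_pmf ?J ?S) (\<omega>', \<nu>) = (if \<omega>' = \<omega> then pmf ?J (\<omega>', \<nu>) / measure ?J ?S else 0)"
    for \<omega>' \<nu>
    by (simp add: pmf_cond[OF ne])
  have "measure_pmf.expectation (induced_given n \<pi> \<omega>) g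
      = measure_pmf.expectation (cond_pmf ?J ?S) (\<lambda>x. g (snd x))"
    by (simp add: induced_given_def)
  also have "\<dots> = (\<Sum>k\<le>n. g (real k / real n) * count_law n \<pi> (\<omega>, k)) / measure ?J ?S"
    unfolding expectation_grid[OF assms(1) supp] sum_divide_distrib cond
    by (cases \<omega>) (simp_all add: count_law_def)
  finally show ?thesis using J assms(2) by simp
qed

lemma prob_correct_bayes_eq:
  assumes "1 \<le> n"
  shows "prob_correct_bayes n \<pi> = (\<Sum>k\<le>n. max (count_law n \<pi> (True, k)) (count_law n \<pi> (False, k)))"
proof -
  let ?J = "induced n \<pi>"
  have 1: "{x :: bool \<times> real. snd x = \<nu>} = {(True, \<nu>), (False, \<nu>)}"
    "{x :: bool \<times> real. fst x \<and> snd x = \<nu>} = {(True, \<nu>)}"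
    "{x :: bool \<times> real. \<not> fst x \<and> snd x = \<nu>} = {(False, \<nu>)}" for \<nu>
    by auto
  \<comment> \<open>Here \<open>x\<close> and \<open>y\<close> are the joint masses of one count. If
    the count has probability 0, division by zero yields 0 and both sides vanish.\<close>
  have 2: "max (y / (x + y)) (x / (x + y)) * x + max (y / (x + y)) (x / (x + y)) * y = max x y"
    if "0 \<le> x" "0 \<le> y" for x y :: real
  proof (cases "x + y = 0")
    case False
    then have "x + y > 0" using that by linarith
    then have eq: "max (y / (x + y)) (x / (x + y)) = max x y / (x + y)"
      by (auto simp: max_def divide_le_cancel)
    show ?thesis
      unfolding eq distrib_left[symmetric] using False by simp
  qed (use that in auto)
  show ?thesis
    unfolding prob_correct_bayes_def integral_map_pmf expectation_grid[OF assms set_induced]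
      sum.distrib[symmetric]
    by (intro sum.cong refl)
       (simp add: cond_prob_def 1 measure_measure_pmf_finite count_law_def 2)
qed

lemma regret_eq_count_regret:
  assumes "1 \<le> n" "p1 < \<mu>" "\<mu> < p2" "0 < \<mu>" "\<mu> < 1" and \<pi>: "\<pi> \<in> info_structures n \<mu> p1 p2"
  shows "regret n \<mu> f \<pi> = count_regret n f (count_law n \<pi>)"
proof -
  have T: "measure \<pi> {x. fst x = True} = \<mu>"
    using \<pi> unfolding mem_info_structures_iff[OF assms(2,3)] by auto
  have F: "measure \<pi> {x. fst x = False} = 1 - \<mu>"
    using prob_state_False[of \<pi>] T by simp
  show ?thesis
    using expectation_induced_given[OF assms(1), of \<pi> True f]
      expectation_induced_given[OF assms(1), of \<pi> False "\<lambda>\<nu>. 1 - f \<nu>"] assms T F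
    by (simp add: regret_def prob_correct_def prob_correct_bayes_eq count_regret_def)
qed

section \<open>Realising every count law by random rotations\<close>

text \<open>Agent \<open>i\<close> gets \<open>H\<close> in exactly \<open>k\<close> of the \<open>n\<close> rotations \<open>r\<close>.\<close>

definition cyclic_profile :: "nat \<Rightarrow> nat \<Rightarrow> nat \<Rightarrow> signal list" where
  "cyclic_profile n k r = map (\<lambda>i. if (i + r) mod n < k then SigH else SigL) [0..<n]"

text \<open>Adding \<open>i\<close> modulo \<open>n\<close> permutes the residues, so the preimage
  of the first \<open>k\<close> residues has \<open>k\<close> elements.\<close>

lemma card_rotation:
  assumes "k \<le> n"
  shows "card {r. r < n \<and> (i + r) mod n < k} = k"
proof (cases "n = 0")
  case False
  have inj: "inj_on (\<lambda>r. (i + r) mod n) {..<n}"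
  proof (rule linorder_inj_onI)
    fix r s assume rs: "r < s" "r \<in> {..<n}" "s \<in> {..<n}"
    then have "\<not> n dvd (i + s) - (i + r)"
      using nat_dvd_not_less[of "s - r" n] by auto
    then show "(i + r) mod n \<noteq> (i + s) mod n"
      using mod_eq_dvd_iff_nat[of "i + r" "i + s" n] rs by auto
  qed auto
  let ?f = "\<lambda>r. (i + r) mod n"
  let ?S = "{r. r < n \<and> ?f r < k}"
  have surj: "?f ` {..<n} = {..<n}"
    using False by (intro endo_inj_surj inj) auto
  have "?f ` ?S = {..<k}"
  proof (intro equalityI subsetI)
    fix j assume "j \<in> {..<k}"
    then have "j \<in> ?f ` {..<n}" unfolding surj using assms by simp
    then show "j \<in> ?f ` ?S" using \<open>j \<in> {..<k}\<close> by auto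
  qed auto
  moreover have "card (?f ` ?S) = card ?S"
    by (intro card_image inj_on_subset[OF inj]) auto
  ultimately show ?thesis by simp
qed (use assms in auto)

lemma frac_H_cyclic_profile:
  assumes "k \<le> n"
  shows "frac_H n (cyclic_profile n k r) = real k / real n"
proof -
  have "{i. i < n \<and> cyclic_profile n k r ! i = SigH} = {i. i < n \<and> (r + i) mod n < k}"
    by (auto simp: cyclic_profile_def add.commute split: if_splits)
  \<comment> \<open>The same count with the roles exchanged: the rotation is fixed and the agent
    varies.\<close>
  then show ?thesis
    using card_rotation[OF assms, of r] by (simp add: frac_H_def)
qed

text \<open>Draw \<open>(\<omega>, k)\<close> from \<open>m\<close> and an independent uniform
  rotation of a profile with \<open>k\<close> signals H. Given \<open>k\<close>, every agent gets H
  with probability \<open>k / n\<close>, so the prescribed mean gives each agent the right joint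
  probability.\<close>

lemma count_law_surj:
  assumes n: "1 \<le> n" and p: "p1 < \<mu>" "\<mu> < p2" and \<mu>: "0 < \<mu>" "\<mu> < 1"
  defines "h \<equiv> (\<mu> - p1) / (p2 - p1)"
  assumes m: "m \<in> count_laws n \<mu> ((1 - p2) * h) (p2 * h)"
  obtains \<pi> where "\<pi> \<in> info_structures n \<mu> p1 p2" "count_law n \<pi> = m"
proof -
  have m_nonneg: "0 \<le> m x" for x using m by (cases x) (simp add: count_laws_def)
  have m0: "m (\<omega>, k) = 0" if "\<not> k \<le> n" for \<omega> k using m that by (simp add: count_laws_def)
  have sums: "(\<Sum>k\<le>n. m (True, k)) = \<mu>" "(\<Sum>k\<le>n. m (False, k)) = 1 - \<mu>"
    "(\<Sum>k\<le>n. real k * m (True, k)) = real n * (p2 * h)"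
    "(\<Sum>k\<le>n. real k * m (False, k)) = real n * ((1 - p2) * h)"
    using m by (simp_all add: count_laws_def)
  define M where "M = embed_pmf m"
  have "(\<Sum>x\<in>UNIV \<times> {..n}. m x) = 1"
    using sums sum.cartesian_product[of "\<lambda>\<omega> k. m (\<omega>, k)" "{..n}" UNIV] by (simp add: UNIV_bool)
  moreover have "(\<integral>\<^sup>+x. ennreal (m x) \<partial>count_space UNIV) = (\<Sum>x\<in>UNIV \<times> {..n}. ennreal (m x))"
    using m0 by (intro nn_integral_count_space') (auto simp flip: not_le, metis ennreal_0)
  ultimately have "(\<integral>\<^sup>+x. ennreal (m x) \<partial>count_space UNIV) = 1"
    by (simp add: sum_ennreal m_nonneg)
  then have M: "pmf M x = m x" for x
    unfolding M_def by (intro pmf_embed_pmf m_nonneg)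
  have M_supp: "k \<le> n" if "(\<omega>, k) \<in> set_pmf M" for \<omega> k
    using that m0[of k \<omega>] by (auto simp: set_pmf_iff M)
  define R where "R = pmf_of_set {..<n}"
  have R: "pmf R r = 1 / real n" "r \<in> set_pmf R" if "r < n" for r
    using n that by (auto simp: R_def lessThan_empty_iff)
  have R_set: "set_pmf R = {..<n}"
    using n by (auto simp: R_def lessThan_empty_iff)
  define \<pi> where "\<pi> = map_pmf (\<lambda>((\<omega>, k), r). (\<omega>, cyclic_profile n k r)) (pair_pmf M R)"
  have "induced n \<pi> = map_pmf (\<lambda>((\<omega>, k), r). (\<omega>, real k / real n)) (pair_pmf M R)"
    unfolding induced_def \<pi>_def map_pmf_comp
    by (intro map_pmf_cong refl) (auto simp: frac_H_cyclic_profile M_supp)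
  also have "\<dots> = map_pmf (\<lambda>(\<omega>, k). (\<omega>, real k / real n)) (map_pmf fst (pair_pmf M R))"
    unfolding map_pmf_comp by (simp add: case_prod_unfold)
  finally have ind: "induced n \<pi> = map_pmf (\<lambda>(\<omega>, k). (\<omega>, real k / real n)) M"
    by (simp add: map_fst_pair_pmf)
  have "pmf (induced n \<pi>) (\<omega>, real k / real n) = m (\<omega>, k)" for \<omega> k
  proof -
    have "inj (\<lambda>(\<omega> :: bool, k). (\<omega>, real k / real n))"
      using n by (auto simp: inj_on_def)
    from pmf_map_inj'[OF this, of M "(\<omega>, k)"] show ?thesis
      by (simp add: ind M)
  qed
  then have law: "count_law n \<pi> = m"
    using m0 by (auto simp: count_law_def fun_eq_iff)
  have H: "measure \<pi> {x. fst x = \<omega> \<and> snd x ! i = SigH} = (\<Sum>k\<le>n. real k * m (\<omega>, k)) / real n"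
    if i: "i < n" for \<omega> i
  proof -
    let ?S = "{((\<omega>', k), r). \<omega>' = \<omega> \<and> k \<le> n \<and> r < n \<and> (i + r) mod n < k}"
    have S: "?S = (\<lambda>(k, r). ((\<omega>, k), r)) ` (SIGMA k:{..n}. {r. r < n \<and> (i + r) mod n < k})"
      by (auto simp: image_iff)
    have fin: "finite ?S" unfolding S by auto
    \<comment> \<open>The two events agree up to a null set: \<open>k \<le> n\<close> and
      \<open>r < n\<close> hold almost surely.\<close>
    have "measure \<pi> {x. fst x = \<omega> \<and> snd x ! i = SigH} = measure (pair_pmf M R) ?S"
      unfolding \<pi>_def measure_map_pmf
      using i by (intro measure_prob_cong_0)
        (auto simp: cyclic_profile_def pmf_pair M m0 R_set set_pmf_iff[symmetric] pmf_eq_0_set_pmf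
          dest: M_supp split: if_splits)
    also have "\<dots> = (\<Sum>x\<in>?S. pmf (pair_pmf M R) x)"
      by (rule measure_measure_pmf_finite[OF fin])
    also have "\<dots> = (\<Sum>(k, r)\<in>(SIGMA k:{..n}. {r. r < n \<and> (i + r) mod n < k}). m (\<omega>, k) / real n)"
      unfolding S by (subst sum.reindex) (auto simp: inj_on_def pmf_pair M R intro!: sum.cong)
    also have "\<dots> = (\<Sum>k\<le>n. \<Sum>r | r < n \<and> (i + r) mod n < k. m (\<omega>, k) / real n)"
      by (subst sum.Sigma) auto
    also have "\<dots> = (\<Sum>k\<le>n. real k * m (\<omega>, k)) / real n"
      unfolding sum_divide_distrib by (intro sum.cong refl) (simp add: card_rotation)
    finally show ?thesis .
  qed
  have "set_pmf \<pi> \<subseteq> UNIV \<times> {s. length s = n}"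
    by (auto simp: \<pi>_def cyclic_profile_def)
  moreover have "measure \<pi> {x. fst x} = \<mu>"
    using sum_count_law_1[OF n, of \<pi> True] by (simp add: law sums)
  ultimately have "\<pi> \<in> info_structures n \<mu> p1 p2"
    unfolding mem_info_structures_iff[OF p] h_def[symmetric]
    using H[of _ True] H[of _ False] n by (simp add: sums)
  with law show ?thesis using that by blast
qed

text \<open>Regrets of information structures are exactly the regrets of count laws. A continuous
  function on a nonempty compact set attains its maximum, so \<open>GREATEST\<close> denotes
  it.\<close>

lemma worst_regret_greatest:
  assumes n: "1 \<le> n" and p: "p1 < \<mu>" "\<mu> < p2" and \<mu>: "0 < \<mu>" "\<mu> < 1"
  defines "h \<equiv> (\<mu> - p1) / (p2 - p1)"
  assumes ne: "count_laws n \<mu> ((1 - p2) * h) (p2 * h) \<noteq> {}"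
  shows "\<And>m. m \<in> count_laws n \<mu> ((1 - p2) * h) (p2 * h) \<Longrightarrow> count_regret n f m \<le> worst_regret n \<mu> p1 p2 f"
    and "worst_regret n \<mu> p1 p2 f \<in> count_regret n f ` count_laws n \<mu> ((1 - p2) * h) (p2 * h)"
proof -
  let ?K = "count_laws n \<mu> ((1 - p2) * h) (p2 * h)"
  have img: "regret n \<mu> f ` info_structures n \<mu> p1 p2 = count_regret n f ` ?K"
  proof (intro equalityI subsetI)
    fix r assume "r \<in> regret n \<mu> f ` info_structures n \<mu> p1 p2"
    then show "r \<in> count_regret n f ` ?K"
      using regret_eq_count_regret[OF n p \<mu>] count_law_mem_count_laws[OF n p] unfolding h_def by auto
  next
    fix r assume "r \<in> count_regret n f ` ?K"
    then obtain m where "m \<in> ?K" "r = count_regret n f m" by auto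
    moreover obtain \<pi> where "\<pi> \<in> info_structures n \<mu> p1 p2" "count_law n \<pi> = m"
      using count_law_surj[OF n p \<mu>] \<open>m \<in> ?K\<close> unfolding h_def by blast
    ultimately show "r \<in> regret n \<mu> f ` info_structures n \<mu> p1 p2"
      using regret_eq_count_regret[OF n p \<mu>] by auto
  qed
  obtain m where m: "m \<in> ?K" "\<And>m'. m' \<in> ?K \<Longrightarrow> count_regret n f m' \<le> count_regret n f m"
    using continuous_attains_sup[OF compact_count_laws ne continuous_on_count_regret[of _ n f]] \<mu> by auto
  have "worst_regret n \<mu> p1 p2 f = count_regret n f m"
    unfolding worst_regret_def img using m by (intro Greatest_equality) auto
  then show "\<And>m. m \<in> ?K \<Longrightarrow> count_regret n f m \<le> worst_regret n \<mu> p1 p2 f"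
    "worst_regret n \<mu> p1 p2 f \<in> count_regret n f ` ?K"
    using m by auto
qed

section \<open>Optimality and uniqueness of the random dictator\<close>

theorem theorem4p3:
  fixes n :: nat and \<mu> p1 p2 a b :: real
  assumes "n \<ge> 1"
    and "0 < \<mu>" and "\<mu> < 1"
    and "0 \<le> p1" and "p1 < 1/2" and "1/2 < p2" and "p2 \<le> 1"
    and "p1 < \<mu>" and "\<mu> < p2"
    and "a = prob_H_state0 \<mu> p1 p2"
    and "b = prob_H_state1 \<mu> p1 p2"
    and "1 / real n \<le> a" and "a < b" and "b \<le> (real n - 1) / real n"
  shows "(\<forall>f. is_arg_min (worst_regret n \<mu> p1 p2) (\<lambda>g. g \<in> aggregation_rules n) f
              \<longleftrightarrow> f = random_dictator n)
         \<and> min_regret n \<mu> p1 p2 = 1 - (1 - \<mu>) * (1 - a) - \<mu> * b"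
proof -
  let ?r = "1 - (1 - \<mu>) * (1 - a) - \<mu> * b"
  let ?W = "worst_regret n \<mu> p1 p2"
  define h where "h = (\<mu> - p1) / (p2 - p1)"
  \<comment> \<open>Each side is the joint probability of signal H and one state, conditioned on the
    signal on the left and on the state on the right.\<close>
  have ca: "(1 - p2) * h = (1 - \<mu>) * a" and cb: "p2 * h = \<mu> * b"
    using assms by (auto simp: h_def prob_H_state0_def prob_H_state1_def)
  let ?K = "count_laws n \<mu> ((1 - \<mu>) * a) (\<mu> * b)"
  have h: "0 < h" "h < 1" and mu: "\<mu> = p2 * h + p1 * (1 - h)"
    using assms by (simp_all add: h_def divide_simps) (simp add: algebra_simps)
  have c1: "(1 - \<mu>) * a < \<mu> * b"
    unfolding ca[symmetric] cb[symmetric] using assms h by simp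
  \<comment> \<open>Signal L has probability \<open>1 - h\<close>, and given L state 0 exceeds state
    1 in probability by \<open>1 - 2 * p1\<close>.\<close>
  have "(1 - \<mu>) * (1 - a) - \<mu> * (1 - b) = (1 - h) * (1 - 2 * p1)"
    using ca cb mu by algebra
  also have "\<dots> > 0" using h assms by simp
  finally have c0: "\<mu> * (1 - b) < (1 - \<mu>) * (1 - a)" by simp
  have rd: "random_dictator n (real k / real n) = real k / real n" if "k \<le> n" for k
    using that by (auto simp: random_dictator_def frac_grid_def)
  have rd_mem: "random_dictator n \<in> aggregation_rules n"
    using assms(1) by (auto simp: random_dictator_def aggregation_rules_def frac_grid_def divide_simps)
  have r_eq: "?r = \<mu> - \<mu> * b + (1 - \<mu>) * a" by (simp add: algebra_simps)
  obtain m where m: "m \<in> ?K" "count_regret n (random_dictator n) m = ?r"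
    unfolding r_eq
    using count_regret_id_attained[OF less_imp_le[OF assms(2)] less_imp_le[OF assms(3)]
        assms(1,12,13,14), where f = "random_dictator n"] rd by blast
  have W: "\<And>m. m \<in> ?K \<Longrightarrow> count_regret n f m \<le> ?W f" "?W f \<in> count_regret n f ` ?K" for f
    using worst_regret_greatest[OF assms(1,8,9,2,3), where f = f] m unfolding h_def[symmetric] ca cb by blast+
  have "?W (random_dictator n) \<le> ?r"
    using W(2)[of "random_dictator n"] count_regret_id_le[OF assms(1) _ rd] r_eq by fastforce
  then have Wrd: "?W (random_dictator n) = ?r"
    using W(1)[OF m(1), of "random_dictator n"] m(2) by simp
  \<comment> \<open>The weak inequality serves twice: it excludes rules with smaller worst-case
    regret and it identifies those with equal worst-case regret.\<close>
  have uniq: "f = random_dictator n" if f: "f \<in> aggregation_rules n" and le: "?W f \<le> ?r" for f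
  proof -
    have grid: "0 \<in> frac_grid n" "1 \<in> frac_grid n"
      using assms(1) by (auto simp: frac_grid_def image_iff intro: bexI[of _ 0] bexI[of _ n])
    have "0 \<le> f 0" "f 1 \<le> 1"
      using f grid by (auto simp: aggregation_rules_def PiE_def Pi_def)
    moreover have "count_regret n f m \<le> ?r" if "m \<in> ?K" for m
      using W(1)[OF that, of f] le by simp
    ultimately have "f (real k / real n) = real k / real n" if "k \<le> n" for k
      using rule_eq_id_if_count_regret_le[OF assms(2,3,1,12,13,14) c1 c0 _ _ _ that, of f] by blast
    then have "f x = random_dictator n x" if "x \<in> frac_grid n" for x
      using that rd by (auto simp: frac_grid_def)
    then show ?thesis
      using f rd_mem unfolding aggregation_rules_def by (intro PiE_ext) auto
  qed
  have gt: "?r \<le> ?W f" if "f \<in> aggregation_rules n" for f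
    using uniq[OF that] Wrd by fastforce
  have "is_arg_min ?W (\<lambda>g. g \<in> aggregation_rules n) f \<longleftrightarrow> f = random_dictator n" for f
    unfolding is_arg_min_def using uniq gt rd_mem Wrd by (metis not_less)
  moreover have "min_regret n \<mu> p1 p2 = ?r"
    unfolding min_regret_def using gt rd_mem Wrd by (intro Least_equality) force+
  ultimately show ?thesis by blast
qed

end
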